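(* Let $\sigma>0$ and $\overline{m},\underline{m}\in\mathbb{R}$ be fixed constants, and let $\xi_1,\xi_2,\dots$ be random variables such that, for every $i\ge1$, $$\hat{\mathbb{E}}\,e^{\lambda(\xi_i-\overline{m})}\le e^{\sigma^2\lambda^2/2}\ \text{ for all }\lambda>0,\qquad \hat{\mathbb{E}}\,e^{\lambda(\xi_i-\underline{m})}\le e^{\sigma^2\lambda^2/2}\ \text{ for all }\lambda<0,$$ and such that, for all real $\lambda$ and $m$ and every positive integer $k$, $$\hat{\mathbb{E}}\prod_{i=1}^k\exp\left(\lambda(\xi_i-m)\right)\le\prod_{i=1}^k\hat{\mathbb{E}}\exp\left(\lambda(\xi_i-m)\right).$$ Let $S_n=\xi_1+\dots+\xi_n$ for every positive integer $n$. Then $$\hat{\mathbb{V}}\left(\left\{\liminf_{n\to\infty}\frac{S_n}{n}<\underline{m}\right\}\cup\left\{\limsup_{n\to\infty}\frac{S_n}{n}>\overline{m}\right\}\right)=0.$$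
   Context: **Sub-linear expectation space.** Let $\Omega$ be a non-empty set and $\mathcal{F}$ a $\sigma$-algebra of subsets of $\Omega$. A random variable is an extended real-valued function $X$ on $\Omega$ with $X^{-1}(A)\in\mathcal{F}$ for every Borel set $A$. Let $\mathcal{H}$ be a set of random variables containing all non-negative random variables. A sub-linear expectation is an extended real-valued function $\hat{\mathbb{E}}[X]$ of $X\in\mathcal{H}$ such that (for elements of $\mathcal{H}$, whenever the expressions involved are well defined): 1. (monotone) if $X\le Y$ then $\hat{\mathbb{E}}[X]\le\hat{\mathbb{E}}[Y]$; 2. (constant preserving) $\hat{\mathbb{E}}[c]=c$ for every $c\in\mathbb{R}$; 3. (sub-additive) $\hat{\mathbb{E}}[X+Y]\le\hat{\mathbb{E}}[X]+\hat{\mathbb{E}}[Y]$, where the case $\hat{\mathbb{E}}[X]+\hat{\mathbb{E}}[Y]=\infty+(-\infty)$ is excluded; 4. (positive homogeneous) $\hat{\mathbb{E}}[\lambda X]=\lambda\hat{\mathbb{E}}[X]$ for every constant $\lambda\ge 0$; 5. (monotone convergence) if $X_n\uparrow X$ and $X_1\ge 0$, then $\hat{\mathbb{E}}[X_n]\uparrow\hat{\mathbb{E}}[X]$. Throughout, such a sub-linear expectation $\hat{\mathbb{E}}$ is given, and the upper probability $\hat{\mathbb{V}}$ on $(\Omega,\mathcal{F})$ satisfies $\hat{\mathbb{V}}(A)=\hat{\mathbb{E}}[\mathbb{I}_A]$ for $A\in\mathcal{F}$, where $\mathbb{I}_A$ is the indicator of $A$. Thus $\hat{\mathbb{V}}$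 is normalized ($\hat{\mathbb{V}}(\Omega)=1$, $\hat{\mathbb{V}}(\emptyset)=0$), monotone, sub-additive ($\hat{\mathbb{V}}(A\cup B)\le\hat{\mathbb{V}}(A)+\hat{\mathbb{V}}(B)$) and lower-continuous ($A_n\uparrow A$ implies $\hat{\mathbb{V}}(A_n)\uparrow\hat{\mathbb{V}}(A)$). An event $A$ is quasi-sure (q.s.) if $\hat{\mathbb{V}}(A^c)=0$; relations between random variables are understood quasi-surely. *)

theory Defs
  imports "HOL-Analysis.Analysis"
begin

text \<open>The exponential on the extended reals, with \<open>exp \<infinity> = \<infinity>\<close> and \<open>exp (- \<infinity>) = 0\<close>.\<close>

fun ereal_exp :: "ereal \<Rightarrow> ereal" where
  "ereal_exp (ereal x) = ereal (exp x)"
| "ereal_exp PInfty = \<infinity>"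
| "ereal_exp MInfty = 0"

text \<open>The sum of two extended reals is meaningful unless it is \<open>\<infinity> + (- \<infinity>)\<close>; the type
  \<^typ>\<open>ereal\<close> totalises the excluded case.\<close>

definition plus_defined :: "ereal \<Rightarrow> ereal \<Rightarrow> bool" where
  "plus_defined a b \<longleftrightarrow> \<not> (a = \<infinity> \<and> b = - \<infinity>) \<and> \<not> (a = - \<infinity> \<and> b = \<infinity>)"

definition increases_to :: "(nat \<Rightarrow> ereal) \<Rightarrow> ereal \<Rightarrow> bool" where
  "increases_to x l \<longleftrightarrow> incseq x \<and> x \<longlonglongrightarrow> l"

text \<open>Only the underlying measurable space of \<open>M\<close> is used: \<open>space M\<close> is the sample space,
  \<open>sets M\<close> its sigma-algebra, and the random variables are the elements of
  \<open>borel_measurable M\<close> with values in \<^typ>\<open>ereal\<close>. The measure carried by \<open>M\<close> plays no role.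
  Outside \<open>H\<close> the values of \<open>E\<close> are irrelevant. In \<open>pos_homogeneous\<close>, \<^typ>\<open>ereal\<close> has
  \<open>0 * \<infinity> = 0\<close>.\<close>

locale sublinear_expectation =
  fixes M :: "'a measure"
    and H :: "('a \<Rightarrow> ereal) set"
    and E :: "('a \<Rightarrow> ereal) \<Rightarrow> ereal"
  assumes nonempty: "space M \<noteq> {}"
    and random_variables: "H \<subseteq> borel_measurable M"
    and nonneg_in_H: "\<And>X. X \<in> borel_measurable M \<Longrightarrow> (\<forall>\<omega>\<in>space M. 0 \<le> X \<omega>) \<Longrightarrow> X \<in> H"
    and monotone: "\<And>X Y. X \<in> H \<Longrightarrow> Y \<in> H \<Longrightarrow> (\<forall>\<omega>\<in>space M. X \<omega> \<le> Y \<omega>) \<Longrightarrow> E X \<le> E Y"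
    and const_preserving: "\<And>c :: real. (\<lambda>_. ereal c) \<in> H \<Longrightarrow> E (\<lambda>_. ereal c) = ereal c"
    and sub_additive: "\<And>X Y. X \<in> H \<Longrightarrow> Y \<in> H
      \<Longrightarrow> (\<forall>\<omega>\<in>space M. plus_defined (X \<omega>) (Y \<omega>)) \<Longrightarrow> (\<lambda>\<omega>. X \<omega> + Y \<omega>) \<in> H
      \<Longrightarrow> plus_defined (E X) (E Y) \<Longrightarrow> E (\<lambda>\<omega>. X \<omega> + Y \<omega>) \<le> E X + E Y"
    and pos_homogeneous: "\<And>(l :: real) X. 0 \<le> l \<Longrightarrow> X \<in> H \<Longrightarrow> (\<lambda>\<omega>. ereal l * X \<omega>) \<in> H
      \<Longrightarrow> E (\<lambda>\<omega>. ereal l * X \<omega>) = ereal l * E X"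
    and monotone_convergence: "\<And>(X :: nat \<Rightarrow> 'a \<Rightarrow> ereal) Y. (\<And>n. X n \<in> H) \<Longrightarrow> Y \<in> H
      \<Longrightarrow> (\<forall>\<omega>\<in>space M. 0 \<le> X 0 \<omega>)
      \<Longrightarrow> (\<forall>\<omega>\<in>space M. increases_to (\<lambda>n. X n \<omega>) (Y \<omega>))
      \<Longrightarrow> increases_to (\<lambda>n. E (X n)) (E Y)"

definition upper_prob :: "(('a \<Rightarrow> ereal) \<Rightarrow> ereal) \<Rightarrow> 'a set \<Rightarrow> ereal" where
  "upper_prob E A = E (indicator A)"

end

theory Submission
  imports Defs
begin

text \<open>
  The proof is the Chernoff bound followed by the Borel-Cantelli lemma, and both survive for a
  sub-linear expectation because they use upper bounds only. Fix \<open>e > 0\<close> and \<open>l > 0\<close>. Markov's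
  inequality applied to \<open>exp (l (S\<^sub>n - n m_up))\<close>, whose expectation is at most
  \<open>exp (n \<sigma>\<^sup>2 l\<^sup>2 / 2)\<close> by the product hypothesis, gives
  \<open>V (S\<^sub>n - n m_up \<ge> n e) \<le> exp (n (\<sigma>\<^sup>2 l\<^sup>2 / 2 - l e))\<close>. The choice \<open>l = e / \<sigma>\<^sup>2\<close> makes this
  \<open>exp (- n e\<^sup>2 / (2 \<sigma>\<^sup>2))\<close>, which is summable in \<open>n\<close>. Since \<open>V\<close> is sub-additive and
  lower-continuous it is countably sub-additive (\<open>V_UN_le_suminf\<close>), so Borel-Cantelli
  (\<open>borel_cantelli_polar\<close>) shows that quasi-surely \<open>S\<^sub>n / n < m_up + e\<close> for all large \<open>n\<close>. Letting
  \<open>e\<close> run through \<open>1 / (j + 1)\<close> bounds the limit superior. The limit inferior is the same argument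
  with \<open>- l\<close> and \<open>m_low\<close>; \<open>polar_frequent_deviation\<close> covers both through a sign \<open>s\<close>.

  The variables are extended real-valued, so \<open>S\<^sub>n\<close> may involve \<open>\<infinity> + (- \<infinity>)\<close>, and the product of the
  exponentials may involve \<open>0 * \<infinity>\<close>. Each \<open>\<xi> i\<close> has finite exponential moments of both signs and is
  therefore quasi-surely finite (\<open>polar_infinite\<close>); the Chernoff bound is proved for the products
  themselves, and they are identified with \<open>exp (l (S\<^sub>n - n m))\<close> only where all \<open>\<xi> i\<close> are finite.
\<close>

section \<open>Exponentials and products of extended reals\<close>

lemma ereal_exp_infinity [simp]: "ereal_exp \<infinity> = \<infinity>" "ereal_exp (- \<infinity>) = 0"
  using ereal_exp.simps(2,3) by simp_all

lemma ereal_exp_nonneg: "0 \<le> ereal_exp x"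
  by (cases x) auto

lemma ereal_exp_measurable [measurable]: "ereal_exp \<in> borel_measurable borel"
proof -
  have "ereal_exp = (\<lambda>x. if x = \<infinity> then \<infinity> else if x = - \<infinity> then 0 else ereal (exp (real_of_ereal x)))"
  proof
    fix x show "ereal_exp x = (if x = \<infinity> then \<infinity> else if x = - \<infinity> then 0 else ereal (exp (real_of_ereal x)))"
      by (cases x) auto
  qed
  also have "\<dots> \<in> borel_measurable borel"
    by measurable
  finally show ?thesis .
qed

lemma prod_ereal_exp_real:
  fixes x :: "nat \<Rightarrow> real"
  shows "(\<Prod>i=1..n. ereal_exp (ereal l * (ereal (x i) - ereal m))) = ereal (exp (l * (\<Sum>i=1..n. x i - m)))"
  by (simp add: prod_ereal exp_sum sum_distrib_left)

text \<open>Non-negativity of the product is carried along because the induction step multiplies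
  inequalities between extended reals.\<close>

lemma prod_mono_nonneg_ereal:
  fixes f g :: "'i \<Rightarrow> ereal"
  assumes "\<And>i. i \<in> I \<Longrightarrow> 0 \<le> f i" "\<And>i. i \<in> I \<Longrightarrow> f i \<le> g i"
  shows "0 \<le> prod f I \<and> prod f I \<le> prod g I"
  using assms
proof (induction I rule: infinite_finite_induct)
  case (insert i I)
  then have "0 \<le> prod f I" "prod f I \<le> prod g I" "0 \<le> f i" "f i \<le> g i" by auto
  then show ?case using insert.hyps by (auto intro!: ereal_mult_mono)
qed auto

section \<open>The upper probability\<close>

context sublinear_expectation
begin

abbreviation V where "V \<equiv> upper_prob E"

lemma E_mono_nonneg:
  assumes "X \<in> borel_measurable M" "Y \<in> borel_measurable M"
    and "\<And>\<omega>. \<omega> \<in> space M \<Longrightarrow> 0 \<le> X \<omega>" "\<And>\<omega>. \<omega> \<in> space M \<Longrightarrow> X \<omega> \<le> Y \<omega>"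
  shows "E X \<le> E Y"
  using assms by (intro monotone nonneg_in_H) (auto intro: order_trans)

lemma E_zero: "E (\<lambda>_. 0) = 0"
  using const_preserving[of 0] nonneg_in_H[of "\<lambda>_. 0"] by (simp flip: zero_ereal_def)

lemma E_nonneg:
  assumes "X \<in> borel_measurable M" "\<And>\<omega>. \<omega> \<in> space M \<Longrightarrow> 0 \<le> X \<omega>"
  shows "0 \<le> E X"
  using E_mono_nonneg[of "\<lambda>_. 0" X] assms by (simp add: E_zero)

lemma V_mono:
  assumes "A \<in> sets M" "B \<in> sets M" "A \<subseteq> B"
  shows "V A \<le> V B"
  unfolding upper_prob_def using assms
  by (intro E_mono_nonneg) (auto simp: indicator_def)

lemma V_nonneg: "A \<in> sets M \<Longrightarrow> 0 \<le> V A"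
  unfolding upper_prob_def by (intro E_nonneg) auto

lemma V_empty: "V {} = 0"
proof -
  have "indicator {} = (\<lambda>_ :: 'a. 0 :: ereal)" by auto
  then show ?thesis by (simp add: upper_prob_def E_zero)
qed

lemma V_subadditive:
  assumes [measurable]: "A \<in> sets M" "B \<in> sets M"
  shows "V (A \<union> B) \<le> V A + V B"
proof -
  have "V (A \<union> B) \<le> E (\<lambda>\<omega>. indicator A \<omega> + indicator B \<omega>)"
    unfolding upper_prob_def by (intro E_mono_nonneg) (auto simp: indicator_def)
  also have "\<dots> \<le> V A + V B"
    unfolding upper_prob_def
  proof (intro sub_additive nonneg_in_H)
    show "plus_defined (E (indicator A)) (E (indicator B))"
      using V_nonneg[of A] V_nonneg[of B] by (auto simp: plus_defined_def upper_prob_def)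
  qed (auto simp: plus_defined_def indicator_def)
  finally show ?thesis .
qed

lemma V_lower_continuous:
  assumes meas: "\<And>n. A n \<in> sets M" and inc: "incseq A"
  shows "(\<lambda>n. V (A n)) \<longlonglongrightarrow> V (\<Union>n. A n)"
proof -
  have [measurable]: "\<And>n. A n \<in> sets M" by (fact meas)
  have "increases_to (\<lambda>n. E (indicator (A n))) (E (indicator (\<Union>n. A n)))"
  proof (rule monotone_convergence)
    show "\<forall>\<omega>\<in>space M. increases_to (\<lambda>n. indicator (A n) \<omega>) (indicator (\<Union>n. A n) \<omega>)"
    proof
      fix \<omega>
      have "incseq (\<lambda>n. indicator (A n) \<omega> :: ereal)"
        using inc by (auto simp: incseq_def indicator_def)
      then show "increases_to (\<lambda>n. indicator (A n) \<omega>) (indicator (\<Union>n. A n) \<omega>)"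
        using LIMSEQ_indicator_incseq[OF inc] by (auto simp: increases_to_def)
    qed
  qed (auto intro!: nonneg_in_H)
  then show ?thesis
    by (simp add: increases_to_def upper_prob_def)
qed

text \<open>Countable sub-additivity: finite sub-additivity bounds the partial unions, and
  lower-continuity passes to the limit.\<close>

lemma V_UN_le_suminf:
  assumes meas: "\<And>n. A n \<in> sets M" and le: "\<And>n. V (A n) \<le> ereal (r n)"
    and "summable r"
  shows "V (\<Union>n. A n) \<le> ereal (suminf r)"
proof -
  have r_nonneg: "0 \<le> r n" for n
    using order_trans[OF V_nonneg[OF meas] le, of n] by simp
  have fin: "V (\<Union>i<n. A i) \<le> ereal (\<Sum>i<n. r i)" for n
  proof (induction n)
    case 0
    then show ?case by (simp add: V_empty)
  next
    case (Suc n)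
    have "V (\<Union>i<Suc n. A i) = V ((\<Union>i<n. A i) \<union> A n)"
      by (simp add: lessThan_Suc Un_commute)
    also have "\<dots> \<le> V (\<Union>i<n. A i) + V (A n)"
      using meas by (intro V_subadditive) auto
    also have "\<dots> \<le> ereal (\<Sum>i<n. r i) + ereal (r n)"
      by (intro add_mono Suc le)
    finally show ?case by simp
  qed
  have "(\<lambda>n. V (\<Union>i<n. A i)) \<longlonglongrightarrow> V (\<Union>n. \<Union>i<n. A i)"
    using meas by (intro V_lower_continuous) (fastforce simp: incseq_def)+
  moreover have "(\<Union>n. \<Union>i<n. A i) = (\<Union>n. A n)" by blast
  moreover have "V (\<Union>i<n. A i) \<le> ereal (suminf r)" for n
    using sum_le_suminf[OF \<open>summable r\<close>, of "{..<n}"] r_nonneg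
    by (intro order_trans[OF fin]) auto
  ultimately show ?thesis
    by (metis (no_types, lifting) LIMSEQ_le_const2)
qed

section \<open>Polar sets\<close>

text \<open>Polar sets are those outside of which a property holds quasi-surely. The measurable superset
  is there because \<open>V\<close> is constrained on measurable sets only; with it, polar sets are closed
  under arbitrary subsets, so exceptional events can be compared without measurability proofs.\<close>

definition polar :: "'a set \<Rightarrow> bool" where
  "polar A \<longleftrightarrow> (\<exists>N\<in>sets M. A \<subseteq> N \<and> V N = 0)"

lemma polar_subset: "polar B \<Longrightarrow> A \<subseteq> B \<Longrightarrow> polar A"
  unfolding polar_def by blast

lemma polar_UN:
  assumes "\<And>n. polar (A n)"
  shows "polar (\<Union>n::nat. A n)"
proof -
  obtain N where N: "\<And>n. N n \<in> sets M" "\<And>n. A n \<subseteq> N n" "\<And>n. V (N n) = 0"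
    using assms unfolding polar_def by metis
  have "V (\<Union>n. N n) \<le> 0"
    using V_UN_le_suminf[of N "\<lambda>_. 0"] N by (simp flip: zero_ereal_def)
  moreover have "0 \<le> V (\<Union>n. N n)" using N by (intro V_nonneg) auto
  ultimately have "V (\<Union>n. N n) = 0" by simp
  then show ?thesis
    unfolding polar_def using N by (intro bexI[of _ "\<Union>n. N n"]) auto
qed

lemma polar_Un: "polar A \<Longrightarrow> polar B \<Longrightarrow> polar (A \<union> B)"
  using polar_UN[of "\<lambda>n. if n = 0 then A else B"]
  by (rule polar_subset) (auto split: if_splits)

lemma V_polar: 
  assumes "polar A" "A \<in> sets M"
  shows "V A = 0"
proof -
  obtain N where "N \<in> sets M" "A \<subseteq> N" "V N = 0" using assms unfolding polar_def by blast
  with V_mono[of A N] V_nonneg[of A] assms show ?thesis by simp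
qed

lemma polar_if_V_small:
  assumes "\<And>e. 0 < e \<Longrightarrow> \<exists>N\<in>sets M. A \<subseteq> N \<and> V N \<le> ereal e" "A \<in> sets M"
  shows "polar A"
proof -
  have "V A \<le> 0 + ereal e" if "0 < e" for e
    using assms(1)[OF that] assms(2) V_mono by (metis add_0 order_trans)
  then have "V A \<le> 0" by (rule ereal_le_epsilon2) 
  then have "V A = 0" using V_nonneg[OF assms(2)] by simp
  then show ?thesis using assms(2) by (auto simp: polar_def)
qed

text \<open>The set of points lying in infinitely many \<open>A n\<close> is contained in every tail union, whose upper
  probability is at most a tail of the convergent series.\<close>

lemma borel_cantelli_polar:
  assumes meas: "\<And>n. A n \<in> sets M" and le: "\<And>n. V (A n) \<le> ereal (r n)"
    and "summable r"
  shows "polar (\<Inter>N. \<Union>n. A (n + N))"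
proof (rule polar_if_V_small)
  fix e :: real assume "0 < e"
  then obtain N where N: "norm (\<Sum>i. r (i + N)) < e"
    using suminf_exist_split[OF _ \<open>summable r\<close>] by blast
  have "V (\<Union>n. A (n + N)) \<le> ereal (\<Sum>i. r (i + N))"
    using meas le \<open>summable r\<close> by (intro V_UN_le_suminf) (auto simp: summable_iff_shift)
  also have "\<dots> \<le> ereal e" using N by simp
  finally show "\<exists>B\<in>sets M. (\<Inter>N. \<Union>n. A (n + N)) \<subseteq> B \<and> V B \<le> ereal e"
    using meas by (intro bexI[of _ "\<Union>n. A (n + N)"]) auto
qed (use meas in auto)

text \<open>Apply \<open>E\<close> to \<open>a * indicator {a \<le> X} \<le> X\<close>.\<close>

lemma markov:
  assumes [measurable]: "X \<in> borel_measurable M" and nn: "\<And>\<omega>. \<omega> \<in> space M \<Longrightarrow> 0 \<le> X \<omega>"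
    and "0 < a" "E X \<le> ereal b"
  shows "V {\<omega>\<in>space M. ereal a \<le> X \<omega>} \<le> ereal (b / a)"
proof -
  let ?A = "{\<omega>\<in>space M. ereal a \<le> X \<omega>}"
  have [measurable]: "?A \<in> sets M" by measurable
  have "ereal a * V ?A = E (\<lambda>\<omega>. ereal a * indicator ?A \<omega>)"
    unfolding upper_prob_def using \<open>0 < a\<close>
    by (intro pos_homogeneous[symmetric] nonneg_in_H) auto
  also have "\<dots> \<le> E X"
    using nn \<open>0 < a\<close> by (intro E_mono_nonneg) (auto simp: indicator_def)
  also note \<open>E X \<le> ereal b\<close>
  finally have "ereal a * V ?A \<le> ereal b" .
  then show ?thesis
    using \<open>0 < a\<close> by (cases "V ?A") (auto simp: field_simps)
qed

text \<open>By Markov's inequality \<open>V {X = \<infinity>} \<le> V {X \<ge> a} \<le> b / a\<close> for every \<open>a > 0\<close>.\<close>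

lemma polar_infinite:
  assumes X [measurable]: "X \<in> borel_measurable M" and nn: "\<And>\<omega>. \<omega> \<in> space M \<Longrightarrow> 0 \<le> X \<omega>"
    and b: "E X \<le> ereal b"
  shows "polar {\<omega>\<in>space M. X \<omega> = \<infinity>}"
proof (rule polar_if_V_small)
  fix e :: real assume "0 < e"
  \<comment> \<open>Large enough that \<open>b / a \<le> e\<close>, and positive even when \<open>b = 0\<close>.\<close>
  define a where "a = (\<bar>b\<bar> + 1) / e"
  have "0 < a" using \<open>0 < e\<close> by (simp add: a_def add_pos_nonneg add_nonneg_pos)
  have "V {\<omega>\<in>space M. ereal a \<le> X \<omega>} \<le> ereal (b / a)"
    by (rule markov[OF X nn \<open>0 < a\<close> b])
  also have "\<dots> \<le> ereal e"
  proof -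
    have "b \<le> e * a" using \<open>0 < e\<close> by (simp add: a_def)
    then show ?thesis using \<open>0 < a\<close> by (simp add: field_simps)
  qed
  finally show "\<exists>N\<in>sets M. {\<omega>\<in>space M. X \<omega> = \<infinity>} \<subseteq> N \<and> V N \<le> ereal e"
    by (intro bexI[of _ "{\<omega>\<in>space M. ereal a \<le> X \<omega>}"]) auto
qed measurable

section \<open>Quasi-sure deviation bounds\<close>

text \<open>Exponential growth in expectation at rate \<open>c\<close> excludes pathwise growth at any larger rate
  \<open>d\<close>: Markov's inequality bounds the \<open>n\<close>-th event by \<open>exp (c - d) ^ n\<close>, a convergent geometric
  series. It is applied to products \<open>f n\<close> of exponentials.\<close>

lemma polar_frequent_exponential_growth:
  fixes f :: "nat \<Rightarrow> 'a \<Rightarrow> ereal"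
  assumes meas [measurable]: "\<And>n. f n \<in> borel_measurable M"
    and nn: "\<And>n \<omega>. 0 \<le> f n \<omega>"
    and le: "\<And>n. n \<ge> 1 \<Longrightarrow> E (f n) \<le> ereal (exp c ^ n)"
    and "c < d"
  shows "polar {\<omega>\<in>space M. \<exists>\<^sub>F n in sequentially. ereal (exp d ^ n) \<le> f n \<omega>}"
proof -
  \<comment> \<open>The index is shifted because nothing is known about \<open>E (f 0)\<close>.\<close>
  define A where "A n = {\<omega>\<in>space M. ereal (exp d ^ Suc n) \<le> f (Suc n) \<omega>}" for n
  have "polar (\<Inter>N. \<Union>n. A (n + N))"
  proof (rule borel_cantelli_polar)
    show "A n \<in> sets M" for n unfolding A_def by measurable
    have "V (A n) \<le> ereal (exp c ^ Suc n / exp d ^ Suc n)" for n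
      unfolding A_def using nn le[of "Suc n"] by (intro markov) auto
    then show "V (A n) \<le> ereal (exp (c - d) ^ Suc n)" for n
      by (simp only: exp_diff power_divide)
    show "summable (\<lambda>n. exp (c - d) ^ Suc n)"
      using \<open>c < d\<close> by (subst summable_Suc_iff) (intro summable_geometric, simp)
  qed
  then show ?thesis
  proof (rule polar_subset, safe)
    fix \<omega> N assume "\<omega> \<in> space M" "\<exists>\<^sub>F n in sequentially. ereal (exp d ^ n) \<le> f n \<omega>"
    then obtain n where n: "n \<ge> Suc N" "ereal (exp d ^ n) \<le> f n \<omega>"
      unfolding frequently_sequentially by blast
    then obtain k where "n = Suc (k + N)" by (metis add.commute add_Suc le_iff_add)
    with n \<open>\<omega> \<in> space M\<close> show "\<omega> \<in> (\<Union>n. A (n + N))" by (auto simp: A_def)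
  qed
qed

text \<open>The Chernoff bound at level \<open>e\<close>. The sign \<open>s\<close> selects the tail: \<open>s = 1\<close> controls deviations of
  the mean above \<open>m\<close>, and \<open>s = - 1\<close> those below \<open>m\<close>.\<close>

lemma polar_frequent_deviation:
  fixes \<xi> :: "nat \<Rightarrow> 'a \<Rightarrow> ereal"
  assumes meas: "\<And>i. i \<ge> 1 \<Longrightarrow> \<xi> i \<in> borel_measurable M"
    and mgf: "\<And>i l. i \<ge> 1 \<Longrightarrow> l > 0 \<Longrightarrow>
      E (\<lambda>\<omega>. ereal_exp (ereal (s * l) * (\<xi> i \<omega> - ereal m))) \<le> ereal (exp (\<sigma>\<^sup>2 * l\<^sup>2 / 2))"
    and prod: "\<And>(l :: real) (k :: nat). k \<ge> 1 \<Longrightarrow>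
      E (\<lambda>\<omega>. \<Prod>i=1..k. ereal_exp (ereal l * (\<xi> i \<omega> - ereal m)))
        \<le> (\<Prod>i=1..k. E (\<lambda>\<omega>. ereal_exp (ereal l * (\<xi> i \<omega> - ereal m))))"
    and "\<sigma> > 0" "e > 0"
  shows "polar {\<omega>\<in>space M. (\<forall>i\<ge>1. \<bar>\<xi> i \<omega>\<bar> \<noteq> \<infinity>) \<and>
    (\<exists>\<^sub>F n in sequentially. real n * e \<le> s * (\<Sum>i=1..n. real_of_ereal (\<xi> i \<omega>) - m))}"
proof -
  \<comment> \<open>The minimiser of the Chernoff exponent \<open>\<sigma>\<^sup>2 l\<^sup>2 / 2 - l e\<close>, which becomes \<open>- l e / 2\<close>.\<close>
  define l where "l = e / \<sigma>\<^sup>2"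
  define f where "f i \<omega> = ereal_exp (ereal (s * l) * (\<xi> i \<omega> - ereal m))" for i \<omega>
  have "l > 0" using assms by (simp add: l_def)
  have f_meas: "f i \<in> borel_measurable M" if "i \<ge> 1" for i
    using meas[OF that] unfolding f_def by measurable
  have f_nonneg: "0 \<le> f i \<omega>" for i \<omega> by (simp add: f_def ereal_exp_nonneg)
  have "polar {\<omega>\<in>space M. \<exists>\<^sub>F n in sequentially. ereal (exp (l * e) ^ n) \<le> (\<Prod>i=1..n. f i \<omega>)}"
  proof (rule polar_frequent_exponential_growth)
    show "(\<lambda>\<omega>. \<Prod>i=1..n. f i \<omega>) \<in> borel_measurable M" for n
      using f_meas by (intro borel_measurable_ereal_prod) auto
    show "0 \<le> (\<Prod>i=1..n. f i \<omega>)" for n \<omega>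
      by (intro conjunct1[OF prod_mono_nonneg_ereal[where g = "\<lambda>i. f i \<omega>"]] f_nonneg) simp
    fix n :: nat assume "n \<ge> 1"
    have "E (\<lambda>\<omega>. \<Prod>i=1..n. f i \<omega>) \<le> (\<Prod>i=1..n. E (f i))"
      unfolding f_def by (rule prod[OF \<open>n \<ge> 1\<close>])
    also have "\<dots> \<le> (\<Prod>i=1..n. ereal (exp (\<sigma>\<^sup>2 * l\<^sup>2 / 2)))"
      using mgf[OF _ \<open>l > 0\<close>] f_meas f_nonneg
      by (intro conjunct2[OF prod_mono_nonneg_ereal] E_nonneg) (auto simp: f_def[abs_def])
    also have "\<dots> = ereal (exp (\<sigma>\<^sup>2 * l\<^sup>2 / 2) ^ n)" by (simp add: prod_ereal)
    finally show "E (\<lambda>\<omega>. \<Prod>i=1..n. f i \<omega>) \<le> ereal (exp (\<sigma>\<^sup>2 * l\<^sup>2 / 2) ^ n)" .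
  next
    have "\<sigma>\<^sup>2 * l\<^sup>2 / 2 = l * e / 2"
      using \<open>\<sigma> > 0\<close> by (simp add: l_def power2_eq_square)
    then show "\<sigma>\<^sup>2 * l\<^sup>2 / 2 < l * e" using \<open>l > 0\<close> \<open>e > 0\<close> by simp
  qed
  then show ?thesis
  proof (rule polar_subset, safe)
    fix \<omega> assume fin: "\<forall>i\<ge>1. \<bar>\<xi> i \<omega>\<bar> \<noteq> \<infinity>"
      and freq: "\<exists>\<^sub>F n in sequentially. real n * e \<le> s * (\<Sum>i=1..n. real_of_ereal (\<xi> i \<omega>) - m)"
    have "ereal (exp (l * e) ^ n) \<le> (\<Prod>i=1..n. f i \<omega>)"
      if n: "real n * e \<le> s * (\<Sum>i=1..n. real_of_ereal (\<xi> i \<omega>) - m)" for n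
    proof -
      have "(\<Prod>i=1..n. f i \<omega>)
          = (\<Prod>i=1..n. ereal_exp (ereal (s * l) * (ereal (real_of_ereal (\<xi> i \<omega>)) - ereal m)))"
        unfolding f_def using fin by (intro prod.cong) (auto simp: ereal_real')
      also have "\<dots> = ereal (exp (s * l * (\<Sum>i=1..n. real_of_ereal (\<xi> i \<omega>) - m)))"
        by (rule prod_ereal_exp_real)
      finally have eq: "(\<Prod>i=1..n. f i \<omega>) = \<dots>" .
      have "real n * (l * e) \<le> s * l * (\<Sum>i=1..n. real_of_ereal (\<xi> i \<omega>) - m)"
        using mult_left_mono[OF n, of l] \<open>l > 0\<close> by (simp add: mult_ac)
      then show ?thesis unfolding eq by (simp flip: exp_of_nat_mult)
    qed
    then show "\<exists>\<^sub>F n in sequentially. ereal (exp (l * e) ^ n) \<le> (\<Prod>i=1..n. f i \<omega>)"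
      by (rule frequently_elim1[OF freq])
  qed
qed

end

section \<open>The law of large numbers\<close>

text \<open>The deterministic step, again with a sign \<open>s\<close> so that one estimate serves both limits. The
  levels \<open>1 / (j + 1)\<close> replace all \<open>e > 0\<close>, so that only countably many exceptional sets
  arise.\<close>

lemma mean_limit_bounds:
  fixes x :: "nat \<Rightarrow> real"
  assumes "\<And>j. \<forall>\<^sub>F n in sequentially. s * (\<Sum>i=1..n. x i - m) < real n * inverse (real (Suc j))"
  shows "s = 1 \<Longrightarrow> limsup (\<lambda>n. (\<Sum>i=1..n. ereal (x i)) / ereal (real n)) \<le> ereal m"
    and "s = -1 \<Longrightarrow> ereal m \<le> liminf (\<lambda>n. (\<Sum>i=1..n. ereal (x i)) / ereal (real n))"
proof -
  have ev: "\<forall>\<^sub>F n in sequentially. 0 < n \<and> s * ((\<Sum>i=1..n. x i) / real n - m) \<le> e" if "0 < e" for e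
  proof -
    obtain j where j: "inverse (real (Suc j)) < e" using reals_Archimedean[of e] \<open>0 < e\<close> by auto
    show ?thesis
      using assms[of j] eventually_gt_at_top[of 0]
    proof eventually_elim
      case (elim n)
      have "s * ((\<Sum>i=1..n. x i) / real n - m) = s * (\<Sum>i=1..n. x i - m) / real n"
        using elim by (simp add: sum_subtractf field_simps)
      also have "\<dots> \<le> inverse (real (Suc j))"
        using elim by (simp add: field_simps)
      finally show ?case using elim j by simp
    qed
  qed
  have mean: "(\<Sum>i=1..n. ereal (x i)) / ereal (real n) = ereal ((\<Sum>i=1..n. x i) / real n)" if "0 < n" for n
    using that by simp
  show "limsup (\<lambda>n. (\<Sum>i=1..n. ereal (x i)) / ereal (real n)) \<le> ereal m" if "s = 1"
  proof (rule ereal_le_epsilon2)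
    fix e :: real assume "0 < e"
    have "\<forall>\<^sub>F n in sequentially. (\<Sum>i=1..n. ereal (x i)) / ereal (real n) \<le> ereal (m + e)"
      using ev[OF \<open>0 < e\<close>] by eventually_elim (use that mean in auto)
    then show "limsup (\<lambda>n. (\<Sum>i=1..n. ereal (x i)) / ereal (real n)) \<le> ereal m + ereal e"
      by (simp add: Limsup_bounded)
  qed
  show "ereal m \<le> liminf (\<lambda>n. (\<Sum>i=1..n. ereal (x i)) / ereal (real n))" (is "_ \<le> ?L") if "s = -1"
  proof (rule ereal_le_epsilon2)
    fix e :: real assume "0 < e"
    have "\<forall>\<^sub>F n in sequentially. ereal (m - e) \<le> (\<Sum>i=1..n. ereal (x i)) / ereal (real n)"
      using ev[OF \<open>0 < e\<close>] by eventually_elim (use that mean in auto)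
    then have "ereal (m - e) \<le> ?L" by (rule Liminf_bounded)
    then show "ereal m \<le> ?L + ereal e" by (cases ?L) auto
  qed
qed

theorem theorem5p1:
  fixes M :: "'a measure"
    and H :: "('a \<Rightarrow> ereal) set"
    and E :: "('a \<Rightarrow> ereal) \<Rightarrow> ereal"
    and \<sigma> m_up m_low :: real
    and \<xi> S :: "nat \<Rightarrow> 'a \<Rightarrow> ereal"
  assumes "sublinear_expectation M H E"
    and "\<sigma> > 0"
    and "\<And>i. i \<ge> 1 \<Longrightarrow> \<xi> i \<in> borel_measurable M"
    and "\<And>i l. i \<ge> 1 \<Longrightarrow> l > 0 \<Longrightarrow>
      E (\<lambda>\<omega>. ereal_exp (ereal l * (\<xi> i \<omega> - ereal m_up))) \<le> ereal (exp (\<sigma>\<^sup>2 * l\<^sup>2 / 2))"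
    and "\<And>i l. i \<ge> 1 \<Longrightarrow> l < 0 \<Longrightarrow>
      E (\<lambda>\<omega>. ereal_exp (ereal l * (\<xi> i \<omega> - ereal m_low))) \<le> ereal (exp (\<sigma>\<^sup>2 * l\<^sup>2 / 2))"
    and "\<And>(l :: real) (m :: real) (k :: nat). k \<ge> 1 \<Longrightarrow>
      E (\<lambda>\<omega>. \<Prod>i=1..k. ereal_exp (ereal l * (\<xi> i \<omega> - ereal m)))
        \<le> (\<Prod>i=1..k. E (\<lambda>\<omega>. ereal_exp (ereal l * (\<xi> i \<omega> - ereal m))))"
    and "\<And>n \<omega>. n \<ge> 1 \<Longrightarrow> S n \<omega> = (\<Sum>i=1..n. \<xi> i \<omega>)"
  shows "upper_prob E
      ({\<omega> \<in> space M. liminf (\<lambda>n. S n \<omega> / ereal (real n)) < ereal m_low}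
        \<union> {\<omega> \<in> space M. limsup (\<lambda>n. S n \<omega> / ereal (real n)) > ereal m_up}) = 0"
    (is "upper_prob E ?B = 0")
proof -
  interpret sublinear_expectation M H E by fact
  \<comment> \<open>\<open>S 0\<close> is an arbitrary function and need not be measurable. \<open>T\<close> is measurable for all \<open>n\<close> and
    agrees with the means of \<open>S\<close> from \<open>n = 1\<close> on, so it has the same limits.\<close>
  define T where "T n \<omega> = (\<Sum>i=1..n. \<xi> i \<omega>) / ereal (real n)" for n \<omega>
  have T_meas [measurable]: "T n \<in> borel_measurable M" for n
    unfolding T_def using assms(3) by (intro borel_measurable_ereal_divide borel_measurable_ereal_sum) auto
  have ST: "\<forall>\<^sub>F n in sequentially. S n \<omega> / ereal (real n) = T n \<omega>" for \<omega>
    using eventually_ge_at_top[of 1] by eventually_elim (simp add: T_def assms(7))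
  have B_eq: "?B = {\<omega> \<in> space M. liminf (\<lambda>n. T n \<omega>) < ereal m_low \<or> limsup (\<lambda>n. T n \<omega>) > ereal m_up}"
    using Liminf_eq[OF ST] Limsup_eq[OF ST] by auto
  \<comment> \<open>The exceptional sets: some \<open>\<xi> i\<close> is infinite, or a deviation of size \<open>1 / (j + 1)\<close> recurs.\<close>
  define P where "P i = {\<omega>\<in>space M. 1 \<le> i \<and> \<xi> i \<omega> = \<infinity>}" for i
  define Q where "Q i = {\<omega>\<in>space M. 1 \<le> i \<and> \<xi> i \<omega> = - \<infinity>}" for i
  define D where "D s m j = {\<omega>\<in>space M. (\<forall>i\<ge>1. \<bar>\<xi> i \<omega>\<bar> \<noteq> \<infinity>) \<and>
      (\<exists>\<^sub>F n in sequentially. real n * inverse (real (Suc j))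
         \<le> s * (\<Sum>i=1..n. real_of_ereal (\<xi> i \<omega>) - m))}" for s m :: real and j
  \<comment> \<open>With \<open>l = 1\<close> the exponential is infinite where \<open>\<xi> i = \<infinity>\<close>, with \<open>l = - 1\<close> where \<open>\<xi> i = - \<infinity>\<close>.\<close>
  have exp_polar: "polar {\<omega>\<in>space M. ereal_exp (ereal l * (\<xi> i \<omega> - ereal m)) = \<infinity>}"
    if "1 \<le> i" "E (\<lambda>\<omega>. ereal_exp (ereal l * (\<xi> i \<omega> - ereal m))) \<le> ereal b" for i l m b
  proof (rule polar_infinite[OF _ _ that(2)])
    note [measurable] = assms(3)[OF that(1)]
    show "(\<lambda>\<omega>. ereal_exp (ereal l * (\<xi> i \<omega> - ereal m))) \<in> borel_measurable M" by measurable
  qed (rule ereal_exp_nonneg)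
  have empty: "polar {}" using V_empty by (auto simp: polar_def)
  have "polar (P i)" for i
  proof (cases "1 \<le> i")
    case True
    show ?thesis
      by (rule polar_subset[OF exp_polar[OF True assms(4)[OF True zero_less_one]]]) (auto simp: P_def)
  qed (simp add: P_def empty)
  moreover have "polar (Q i)" for i
  proof (cases "1 \<le> i")
    case True
    show ?thesis
      by (rule polar_subset[OF exp_polar[OF True assms(5)[OF True, of "-1"]]]) (auto simp: Q_def)
  qed (simp add: Q_def empty)
  moreover have "polar (D 1 m_up j)" for j
    unfolding D_def using assms by (intro polar_frequent_deviation[where \<sigma> = \<sigma>]) auto
  moreover have "polar (D (-1) m_low j)" for j
  proof -
    have "E (\<lambda>\<omega>. ereal_exp (ereal (- 1 * l) * (\<xi> i \<omega> - ereal m_low))) \<le> ereal (exp (\<sigma>\<^sup>2 * l\<^sup>2 / 2))"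
      if "i \<ge> 1" "l > 0" for i l
      using assms(5)[OF that(1), of "- l"] that(2) by simp
    then show ?thesis
      unfolding D_def using assms by (intro polar_frequent_deviation[where \<sigma> = \<sigma>]) auto
  qed
  ultimately have "polar ((\<Union>i. P i) \<union> (\<Union>i. Q i) \<union> (\<Union>j. D 1 m_up j) \<union> (\<Union>j. D (-1) m_low j))"
    by (intro polar_Un polar_UN)
  then have "polar ?B"
  proof (rule polar_subset)
    show "?B \<subseteq> (\<Union>i. P i) \<union> (\<Union>i. Q i) \<union> (\<Union>j. D 1 m_up j) \<union> (\<Union>j. D (-1) m_low j)"
    proof (intro subsetI, rule ccontr)
      fix \<omega> assume B: "\<omega> \<in> ?B"
        and notin: "\<omega> \<notin> (\<Union>i. P i) \<union> (\<Union>i. Q i) \<union> (\<Union>j. D 1 m_up j) \<union> (\<Union>j. D (-1) m_low j)"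
      have fin: "\<forall>i\<ge>1. \<bar>\<xi> i \<omega>\<bar> \<noteq> \<infinity>"
        using B notin by (auto simp: P_def Q_def)
      define x where "x i = real_of_ereal (\<xi> i \<omega>)" for i
      have T_x: "(\<lambda>n. T n \<omega>) = (\<lambda>n. (\<Sum>i=1..n. ereal (x i)) / ereal (real n))"
        unfolding T_def x_def using fin
        by (intro ext arg_cong2[where f = "(/)"] sum.cong) (auto simp: ereal_real')
      have ev: "\<forall>\<^sub>F n in sequentially. s * (\<Sum>i=1..n. x i - m) < real n * inverse (real (Suc j))"
        if "\<omega> \<notin> D s m j" for s m j
        using that fin B by (auto simp: D_def frequently_def x_def not_le)
      have "limsup (\<lambda>n. T n \<omega>) \<le> ereal m_up"
        unfolding T_x using notin by (intro mean_limit_bounds(1)[where s = 1] ev) auto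
      moreover have "ereal m_low \<le> liminf (\<lambda>n. T n \<omega>)"
        unfolding T_x using notin by (intro mean_limit_bounds(2)[where s = "-1"] ev) auto
      ultimately show False using B unfolding B_eq by auto
    qed
  qed
  moreover have "?B \<in> sets M" unfolding B_eq by measurable
  ultimately show ?thesis by (rule V_polar)
qed

end
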